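(* Let $T$ be a rooted tree of order $n$ with root $r$. The procedure call $\textsc{Claw-Deletion-Set}(T,r,\emptyset)$ described below returns a minimum claw-deletion set of $T$, and it runs in $\mathcal{O}(n)$ time.
   Context: A claw is $K_{1,3}$; a set $S\subseteq V(G)$ is a claw-deletion set of $G$ if the subgraph induced by $V(G)\setminus S$ has no induced $K_{1,3}$. For a rooted tree $T$ and $v\in V(T)$, $C(v)$ is the set of children of $v$. Procedure $\textsc{Claw-Deletion-Set}(T,v,p)$ (where $p$ is the parent of $v$, or $\emptyset$ if $v$ is the root): if $C(v)=\emptyset$, return $\emptyset$. Otherwise, set $S:=\emptyset$; for each $u \in C(v)$, set $S := S \cup \textsc{Claw-Deletion-Set}(T,u,v)$; let $c := |C(v)\setminus S|$; if $c \geq 3$, set $S := S\cup\{v\}$; else if $c = 2$ and $p \neq \emptyset$ and $v \notin S$, set $S := S \cup \{p\}$; return $S$. *)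

theory Defs
  imports "Graph_Theory.Graph_Theory" "HOL-Library.Monad_Syntax"
begin

section \<open>Rooted trees\<close>

text \<open>
  Finite simple graphs are the symmetric digraphs of locale \<^locale>\<open>graph\<close>. There \<open>u, v, u\<close> is a
  directed cycle for every edge \<open>uv\<close>, so \<^const>\<open>forest\<close> and \<^const>\<open>tree\<close> of the library do not describe
  undirected forests and trees; the cycles of the underlying undirected graph are the directed ones
  of length at least 3.
\<close>

definition undirected_tree :: "('a, 'b) pre_digraph \<Rightarrow> bool" where
  "undirected_tree T \<longleftrightarrow>
     graph T \<and> connected T \<and> \<not> (\<exists>p. pre_digraph.cycle T p \<and> 3 \<le> length p)"

definition rooted_tree :: "('a, 'b) pre_digraph \<Rightarrow> 'a \<Rightarrow> bool" where
  "rooted_tree T r \<longleftrightarrow> undirected_tree T \<and> r \<in> verts T"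

text \<open>\<open>u\<close> is a child of \<open>v\<close> if \<open>v\<close> is the last vertex before \<open>u\<close> on the path from the root to \<open>u\<close>.\<close>

definition children :: "('a, 'b) pre_digraph \<Rightarrow> 'a \<Rightarrow> 'a \<Rightarrow> 'a set" where
  "children T r v = {u. \<exists>q. vpath (q @ [v, u]) T \<and> hd (q @ [v, u]) = r}"


section \<open>Claw-deletion sets\<close>

definition claw_free :: "('a, 'b) pre_digraph \<Rightarrow> bool" where
  "claw_free G \<longleftrightarrow> \<not> (\<exists>W \<subseteq> verts G. K\<^bsub>1,3\<^esub> (G \<restriction> W))"

definition claw_deletion_set :: "('a, 'b) pre_digraph \<Rightarrow> 'a set \<Rightarrow> bool" where
  "claw_deletion_set G S \<longleftrightarrow> S \<subseteq> verts G \<and> claw_free (G \<restriction> (verts G - S))"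

definition minimum_claw_deletion_set :: "('a, 'b) pre_digraph \<Rightarrow> 'a set \<Rightarrow> bool" where
  "minimum_claw_deletion_set G S \<longleftrightarrow>
     claw_deletion_set G S \<and> (\<forall>S'. claw_deletion_set G S' \<longrightarrow> card S \<le> card S')"


section \<open>The procedure\<close>

text \<open>
  \<open>cds_returns T r v p S\<close>: for the tree \<open>T\<close> with root \<open>r\<close>, the call with arguments \<open>v\<close> and \<open>p\<close>
  terminates and returns \<open>S\<close>; \<open>p = None\<close> stands for \<open>p = \<emptyset>\<close>. Here \<open>R u\<close> is the value returned by the
  recursive call for the child \<open>u\<close>, and \<open>S\<close> is the value of the variable after the loop.
\<close>

inductive cds_returns :: "('a, 'b) pre_digraph \<Rightarrow> 'a \<Rightarrow> 'a \<Rightarrow> 'a option \<Rightarrow> 'a set \<Rightarrow> bool"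
  for T :: "('a, 'b) pre_digraph" and r :: 'a where
  leaf: "children T r v = {} \<Longrightarrow> cds_returns T r v p {}"
| inner: "\<lbrakk> children T r v \<noteq> {};
           \<And>u. u \<in> children T r v \<Longrightarrow> cds_returns T r u (Some v) (R u);
           S = (\<Union>u \<in> children T r v. R u);
           c = card (children T r v - S);
           S' = (if c \<ge> 3 then S \<union> {v}
                 else if c = 2 \<and> p \<noteq> None \<and> v \<notin> S then S \<union> {the p}
                 else S) \<rbrakk>
         \<Longrightarrow> cds_returns T r v p S'"


section \<open>Running time\<close>

text \<open>
  Programs of a unit-cost random access machine whose store is a Boolean array indexed by the
  vertices. A program maps the initial store to its value, the final store and the number of
  elementary steps, or to \<^const>\<open>None\<close> if it does not terminate. Array accesses and \<open>tick\<close> cost one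
  step; \<open>tick\<close> accounts for a test, an addition, a procedure call, or moving to the next list cell.
\<close>

type_synonym ('a, 'x) ram = "('a \<Rightarrow> bool) \<Rightarrow> ('x \<times> ('a \<Rightarrow> bool) \<times> nat) option"

definition ram_return :: "'x \<Rightarrow> ('a, 'x) ram" where
  "ram_return x = (\<lambda>m. Some (x, m, 0))"

definition ram_bind :: "('a, 'x) ram \<Rightarrow> ('x \<Rightarrow> ('a, 'y) ram) \<Rightarrow> ('a, 'y) ram" where
  "ram_bind c f = (\<lambda>m. Option.bind (c m) (\<lambda>(x, m1, t1).
                       Option.bind (f x m1) (\<lambda>(y, m2, t2). Some (y, m2, t1 + t2))))"

adhoc_overloading Monad_Syntax.bind \<rightleftharpoons> ram_bind

definition tick :: "('a, unit) ram" where
  "tick = (\<lambda>m. Some ((), m, 1))"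

definition read :: "'a \<Rightarrow> ('a, bool) ram" where
  "read x = (\<lambda>m. Some (m x, m, 1))"

definition "write" :: "'a \<Rightarrow> bool \<Rightarrow> ('a, unit) ram" where
  "write x b = (\<lambda>m. Some ((), m(x := b), 1))"

primrec for_each :: "'a list \<Rightarrow> ('a \<Rightarrow> ('a, unit) ram) \<Rightarrow> ('a, unit) ram" where
  "for_each [] f = tick"
| "for_each (x # xs) f = do { tick; f x; for_each xs f }"

primrec count_unmarked :: "'a list \<Rightarrow> nat \<Rightarrow> ('a, nat) ram" where
  "count_unmarked [] c = do { tick; ram_return c }"
| "count_unmarked (x # xs) c = do {
     tick;
     b \<leftarrow> read x;
     if b then count_unmarked xs c else do { tick; count_unmarked xs (c + 1) }
   }"

abbreviation "mono_ram \<equiv> monotone (fun_ord option_ord) option_ord"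

lemma ram_bind_mono [partial_function_mono]:
  assumes "\<And>m. mono_ram (\<lambda>f. c f m)" and "\<And>x m. mono_ram (\<lambda>f. g f x m)"
  shows "mono_ram (\<lambda>f. ram_bind (c f) (g f) m)"
  unfolding ram_bind_def
  by (intro bind_mono assms) (auto simp: case_prod_beta intro!: bind_mono assms option.const_mono)

lemma ram_if_mono [partial_function_mono]:
  assumes "mono_ram (\<lambda>f. c f m)" and "mono_ram (\<lambda>f. d f m)"
  shows "mono_ram (\<lambda>f. (if b then c f else d f) m)"
  using assms by (cases b) simp_all

lemma for_each_mono [partial_function_mono]:
  assumes "\<And>x m. mono_ram (\<lambda>f. g f x m)"
  shows "mono_ram (\<lambda>f. for_each xs (g f) m)"
  by (induction xs arbitrary: m) (auto intro!: ram_bind_mono assms option.const_mono)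

text \<open>
  The procedure on child lists \<open>ch\<close>. All calls share one array, the characteristic function of \<open>S\<close>:
  a union \<open>S := S \<union> \<dots>\<close> with the value of a recursive call is carried out by the writes of that call.
\<close>

partial_function (option) cds_ram ::
    "('a \<Rightarrow> 'a list) \<Rightarrow> 'a \<Rightarrow> 'a option \<Rightarrow> ('a \<Rightarrow> bool) \<Rightarrow> (unit \<times> ('a \<Rightarrow> bool) \<times> nat) option" where
  "cds_ram ch v p m = (do {
     tick;
     if ch v = [] then ram_return ()
     else do {
       for_each (ch v) (\<lambda>u. do { tick; cds_ram ch u (Some v) });
       c \<leftarrow> count_unmarked (ch v) 0;
       tick;
       if c \<ge> 3 then write v True
       else do {
         tick;
         if c = 2 then do {
           tick;
           if p \<noteq> None then do {
             b \<leftarrow> read v;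
             if \<not> b then write (the p) True else ram_return ()
           } else ram_return ()
         } else ram_return ()
       }
     }
   }) m"

text \<open>The initial content of the array is arbitrary; \<open>vs\<close> lists the vertices.\<close>

definition cds_main :: "'a list \<Rightarrow> ('a \<Rightarrow> 'a list) \<Rightarrow> 'a \<Rightarrow> ('a, unit) ram" where
  "cds_main vs ch r = do { for_each vs (\<lambda>v. write v False); cds_ram ch r None }"

definition tree_input ::
    "('a, 'b) pre_digraph \<Rightarrow> 'a \<Rightarrow> 'a list \<Rightarrow> ('a \<Rightarrow> 'a list) \<Rightarrow> bool" where
  "tree_input T r vs ch \<longleftrightarrow>
     distinct vs \<and> set vs = verts T \<and>
     (\<forall>v \<in> verts T. distinct (ch v) \<and> set (ch v) = children T r v)"

end

theory Submission
  imports Defs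
begin

text \<open>
  Call a vertex marked if it has at least three unmarked children, or an unmarked child that has at
  least two unmarked children. This is a recursion from the leaves upwards, and the procedure returns
  the set of marked vertices. No claw avoids them: a claw with unmarked vertices and center \<open>c\<close> has at
  least two leaves among the children of \<open>c\<close>, and then either \<open>c\<close> or its parent in the claw is marked.
  They are a minimum claw-deletion set by packing: every marked \<open>s\<close> lies in a claw whose other vertices
  are unmarked and are children of \<open>s\<close>, or children of an unmarked child of \<open>s\<close>. Such a vertex determines
  \<open>s\<close>, since it is the first marked proper ancestor. So these claws are pairwise disjoint, and every
  claw-deletion set hits each of them.
\<close>

section \<open>The marked vertices and the value of the procedure\<close>

text \<open>A forest is reduced to its child sets, so the procedure can be analysed without graphs.
  Well-foundedness permits recursion from the leaves upwards. \<open>graph_tree\<close> later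
  becomes an instance.\<close>

locale child_system =
  fixes C :: "'a \<Rightarrow> 'a set"
  assumes finite_children: "finite (C v)"
    and unique_parent: "u \<in> C v \<Longrightarrow> u \<in> C w \<Longrightarrow> v = w"
    and wf_children: "wf {(u, v). u \<in> C v}"
begin

abbreviation child_rel :: "('a \<times> 'a) set" where
  "child_rel \<equiv> {(u, v). u \<in> C v}"

text \<open>Grandchildren occur in the recursion, hence the transitive closure.\<close>

definition marked :: "'a \<Rightarrow> bool" where
  "marked = wfrec (child_rel\<^sup>+) (\<lambda>f v.
     3 \<le> card {w \<in> C v. \<not> f w} \<or> (\<exists>u \<in> C v. \<not> f u \<and> 2 \<le> card {w \<in> C u. \<not> f w}))"

definition unmarked_children :: "'a \<Rightarrow> 'a set" where
  "unmarked_children v = {w \<in> C v. \<not> marked w}"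

text \<open>\<open>cut\<close> does no harm: the recursion consults only children and grandchildren
  of \<open>v\<close>, which lie below \<open>v\<close> in the transitive closure.\<close>

lemma marked_iff:
  "marked v \<longleftrightarrow> 3 \<le> card (unmarked_children v) \<or>
     (\<exists>u \<in> C v. \<not> marked u \<and> 2 \<le> card (unmarked_children u))"
proof -
  have c1: "cut marked (child_rel\<^sup>+) v w = marked w" if "w \<in> C v" for w
    using that by (intro cut_apply) auto
  have c2: "cut marked (child_rel\<^sup>+) v w = marked w" if "w \<in> C u" "u \<in> C v" for w u
    using that by (intro cut_apply) (auto intro: trancl_into_trancl)
  have s1: "{w \<in> C v. \<not> cut marked (child_rel\<^sup>+) v w} = unmarked_children v"
    using c1 by (auto simp: unmarked_children_def)
  have s2: "{w \<in> C u. \<not> cut marked (child_rel\<^sup>+) v w} = unmarked_children u" if "u \<in> C v" for u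
    using c2 that by (auto simp: unmarked_children_def)
  have "marked v \<longleftrightarrow> 3 \<le> card {w \<in> C v. \<not> cut marked (child_rel\<^sup>+) v w} \<or>
      (\<exists>u \<in> C v. \<not> cut marked (child_rel\<^sup>+) v u \<and>
         2 \<le> card {w \<in> C u. \<not> cut marked (child_rel\<^sup>+) v w})"
    by (rule def_wfrec[OF eq_reflection[OF marked_def] wf_trancl[OF wf_children]])
  then show ?thesis
    using c1 s1 s2 by auto
qed

lemma finite_unmarked_children: "finite (unmarked_children v)"
  using finite_children by (simp add: unmarked_children_def)

section \<open>Subtrees and their sizes\<close>

definition descendants :: "'a \<Rightarrow> 'a set" where
  "descendants v = {x. (x, v) \<in> child_rel\<^sup>*}"

lemma self_in_descendants: "v \<in> descendants v"
  by (simp add: descendants_def)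

lemma descendants_unfold: "descendants v = insert v (\<Union>u \<in> C v. descendants u)"
  unfolding descendants_def by (auto elim: rtrancl.cases intro: rtrancl_into_rtrancl)

lemma descendants_trans: "x \<in> descendants u \<Longrightarrow> u \<in> descendants v \<Longrightarrow> x \<in> descendants v"
  unfolding descendants_def by auto

lemma parent_notin_descendants:
  assumes "u \<in> C v" shows "v \<notin> descendants u"
proof
  assume "v \<in> descendants u"
  then have "(v, v) \<in> child_rel\<^sup>+"
    using assms unfolding descendants_def by (auto intro: rtrancl_into_trancl1)
  then show False
    using wf_trancl[OF wf_children] by (auto dest: wf_not_refl)
qed

lemma children_subset_descendants: "C v \<subseteq> descendants v"
  using descendants_unfold[of v] self_in_descendants by blast

lemma self_notin_children: "v \<notin> C v"
  using parent_notin_descendants self_in_descendants by blast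

text \<open>A path upwards from \<open>u\<close> to a different vertex starts with the step to its
  only parent \<open>v\<close>, which would put \<open>v\<close> below its own child
  \<open>u'\<close>.\<close>

lemma sibling_notin_descendants:
  assumes "u \<in> C v" "u' \<in> C v" "u \<noteq> u'"
  shows "u \<notin> descendants u'"
proof
  assume "u \<in> descendants u'"
  then have "(u, u') \<in> child_rel\<^sup>*" by (simp add: descendants_def)
  then obtain w where "u \<in> C w" "(w, u') \<in> child_rel\<^sup>*"
    using assms(3) by (auto elim: converse_rtranclE)
  then have "v \<in> descendants u'"
    using unique_parent[OF assms(1)] by (auto simp: descendants_def)
  then show False using parent_notin_descendants assms(2) by blast
qed

text \<open>As parents are unique, the ancestors of a vertex form a chain. A common descendant would
  make one sibling a descendant of the other.\<close>

lemma descendants_siblings_disjoint: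
  assumes "u \<in> C v" "u' \<in> C v" "u \<noteq> u'"
  shows "descendants u \<inter> descendants u' = {}"
proof -
  have "single_valued child_rel"
    using unique_parent by (auto simp: single_valued_def)
  then show ?thesis
    using single_valued_confluent[of child_rel _ u u'] sibling_notin_descendants assms
    unfolding descendants_def by blast
qed

lemma finite_descendants: "finite (descendants v)"
  using wf_children
  by (induction v rule: wf_induct_rule) (subst descendants_unfold, auto simp: finite_children)

lemma card_descendants: "card (descendants v) = Suc (\<Sum>u \<in> C v. card (descendants u))"
proof -
  have "card (\<Union>u \<in> C v. descendants u) = (\<Sum>u \<in> C v. card (descendants u))"
    by (rule card_UN_disjoint)
      (auto simp: finite_children finite_descendants dest: descendants_siblings_disjoint)
  moreover have "v \<notin> (\<Union>u \<in> C v. descendants u)"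
    using parent_notin_descendants by blast
  ultimately show ?thesis
    by (subst descendants_unfold) (simp add: finite_children finite_descendants)
qed

text \<open>The value returned by the call with arguments \<open>v\<close> and \<open>p\<close>, in closed form.\<close>

definition cds_value :: "'a \<Rightarrow> 'a option \<Rightarrow> 'a set" where
  "cds_value v p = {x \<in> descendants v. marked x} \<union>
     (if \<not> marked v \<and> card (unmarked_children v) = 2 then set_option p else {})"

lemma cds_value_leaf: "C v = {} \<Longrightarrow> cds_value v p = {}"
  using descendants_unfold[of v] marked_iff[of v]
  by (auto simp: cds_value_def unmarked_children_def)

text \<open>For unmarked \<open>v\<close>, this makes the test \<open>c = 2\<close> of the procedure
  equivalent to the bound \<open>2 \<le>\<close> in the recursion for \<open>marked\<close>.\<close>

lemma unmarked_card_le: "\<not> marked v \<Longrightarrow> card (unmarked_children v) \<le> 2"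
  using marked_iff[of v] by auto

text \<open>This is \<open>S\<close> after the loop. The calls for the children contribute vertices
  of their own subtrees, except that a child may add its parent; that is the optional
  \<open>{v}\<close>.\<close>

lemma cds_value_Union:
  "(\<Union>u \<in> C v. cds_value u (Some v)) =
     {x \<in> descendants v - {v}. marked x} \<union>
     (if \<exists>u \<in> C v. \<not> marked u \<and> 2 \<le> card (unmarked_children u) then {v} else {})"
  (is "?L = ?D \<union> ?V")
proof -
  have "descendants v - {v} = (\<Union>u \<in> C v. descendants u)"
    using descendants_unfold[of v] parent_notin_descendants[of _ v] by blast
  then have D: "?D = (\<Union>u \<in> C v. {x \<in> descendants u. marked x})" by auto
  have "(2 \<le> card (unmarked_children u)) = (card (unmarked_children u) = 2)" if "\<not> marked u" for u
    using unmarked_card_le[OF that] by auto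
  then have V: "?V = (\<Union>u \<in> C v. if \<not> marked u \<and> card (unmarked_children u) = 2 then {v} else {})"
    by auto
  show ?thesis
    unfolding D V cds_value_def by (simp only: UN_Un_distrib option.set)
qed

text \<open>The possible extra element \<open>v\<close> is not a child of \<open>v\<close>, so the
  procedure's \<open>c\<close> counts exactly the unmarked children.\<close>

lemma unmarked_children_conv_diff:
  "C v - (\<Union>u \<in> C v. cds_value u (Some v)) = unmarked_children v"
  unfolding cds_value_Union unmarked_children_def
  using children_subset_descendants self_notin_children by auto

lemma self_in_cds_value_Union_iff:
  "v \<in> (\<Union>u \<in> C v. cds_value u (Some v)) \<longleftrightarrow>
     (\<exists>u \<in> C v. \<not> marked u \<and> 2 \<le> card (unmarked_children u))"
  unfolding cds_value_Union by auto

text \<open>The closed form satisfies the body of the procedure: \<open>v\<close> is marked by its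
  own test or through the value of a child's call, as in the two clauses of
  \<open>marked_iff\<close>. The equation serves both the inductive relation and the array
  program.\<close>

lemma cds_value_step:
  fixes v p
  defines "S \<equiv> \<Union>u \<in> C v. cds_value u (Some v)"
  shows "cds_value v p =
    (if 3 \<le> card (C v - S) then S \<union> {v}
     else if card (C v - S) = 2 \<and> p \<noteq> None \<and> v \<notin> S then S \<union> {the p}
     else S)"
proof -
  have "marked v \<longleftrightarrow> 3 \<le> card (C v - S) \<or> v \<in> S"
    unfolding S_def unmarked_children_conv_diff self_in_cds_value_Union_iff by (rule marked_iff)
  moreover have "{x \<in> descendants v. marked x} = (if marked v then insert v (S - {v}) else S - {v})"
    unfolding S_def cds_value_Union using self_in_descendants[of v] by auto
  moreover have "card (C v - S) = card (unmarked_children v)"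
    unfolding S_def unmarked_children_conv_diff ..
  ultimately show ?thesis
    unfolding cds_value_def[of v p] by (cases p) auto
qed

end

text \<open>Rule induction shows that no other value can be returned. Well-founded induction shows
  that this one is returned, which includes termination.\<close>

lemma cds_returns_iff:
  assumes "child_system (children T r)"
  shows "cds_returns T r v p S \<longleftrightarrow> S = child_system.cds_value (children T r) v p"
proof -
  interpret child_system "children T r" by fact
  have unique: "S = cds_value v p" if "cds_returns T r v p S" for v p S
    using that
  proof induction
    case (leaf v p)
    then show ?case by (simp add: cds_value_leaf)
  next
    case (inner v R S c S' p)
    have "S = (\<Union>u \<in> children T r v. cds_value u (Some v))"
      unfolding inner.hyps(3) by (rule SUP_cong[OF refl inner.IH])
    then show ?case
      unfolding inner.hyps(4,5) by (simp only: cds_value_step[of v p])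
  qed
  have exists: "cds_returns T r v p (cds_value v p)" for v p
    using wf_children
  proof (induction v arbitrary: p rule: wf_induct_rule)
    case (less v)
    show ?case
    proof (cases "children T r v = {}")
      case True
      then show ?thesis by (auto simp: cds_value_leaf intro: leaf)
    next
      case False
      then show ?thesis
        by (rule inner[where R = "\<lambda>u. cds_value u (Some v)", OF _ _ refl refl cds_value_step])
          (use less in auto)
    qed
  qed
  show ?thesis using unique exists by blast
qed

section \<open>Running time on child lists\<close>

text \<open>With the next two lemmas, simplification runs a program step by step and collects the
  cost under \<open>map_option\<close>.\<close>

lemma ram_bind_Some:
  assumes "c m = Some (x, m1, t1)"
  shows "ram_bind c f m = map_option (\<lambda>(y, m2, t2). (y, m2, t1 + t2)) (f x m1)"
  using assms by (cases "f x m1") (auto simp: ram_bind_def)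

lemma ram_bind_tick:
  "ram_bind tick f m = map_option (\<lambda>(y, m2, t2). (y, m2, Suc t2)) (f () m)"
  by (cases "f () m") (auto simp: ram_bind_def tick_def)

lemma ram_bind_read:
  "ram_bind (read x) f m = map_option (\<lambda>(y, m2, t2). (y, m2, Suc t2)) (f (m x) m)"
  by (cases "f (m x) m") (auto simp: ram_bind_def read_def)

text \<open>\<open>Q u\<close> is the region that must be clear before the iteration for
  \<open>u\<close>, and \<open>R u\<close> is what it sets. \<open>R u\<close> may reach beyond
  \<open>Q u\<close> but avoids the regions of the other iterations, so their preconditions
  survive.\<close>

lemma for_each_unions:
  fixes m :: "'a \<Rightarrow> bool"
  assumes "\<And>u m. u \<in> set us \<Longrightarrow> \<forall>x \<in> Q u. \<not> m x \<Longrightarrow>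
      \<exists>t. f u m = Some ((), \<lambda>x. m x \<or> x \<in> R u, t) \<and> t \<le> B u"
    and "\<And>u u'. u \<in> set us \<Longrightarrow> u' \<in> set us \<Longrightarrow> u \<noteq> u' \<Longrightarrow> R u \<inter> Q u' = {}"
    and "distinct us" and "\<And>u x. u \<in> set us \<Longrightarrow> x \<in> Q u \<Longrightarrow> \<not> m x"
  shows "\<exists>t. for_each us f m = Some ((), \<lambda>x. m x \<or> x \<in> (\<Union>u \<in> set us. R u), t) \<and>
           t \<le> Suc (\<Sum>u \<in> set us. Suc (B u))"
  using assms
proof (induction us arbitrary: m)
  case Nil
  then show ?case by (simp add: tick_def)
next
  case (Cons u us)
  obtain t where t: "f u m = Some ((), \<lambda>x. m x \<or> x \<in> R u, t)" "t \<le> B u"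
    using Cons.prems(1)[of u m] Cons.prems(4)[of u] by auto
  let ?m = "\<lambda>x. m x \<or> x \<in> R u"
  have "\<exists>t. for_each us f ?m = Some ((), \<lambda>x. ?m x \<or> x \<in> (\<Union>u \<in> set us. R u), t) \<and>
           t \<le> Suc (\<Sum>u \<in> set us. Suc (B u))"
  proof (rule Cons.IH)
    fix u' x assume "u' \<in> set us" "x \<in> Q u'"
    moreover from this have "u \<noteq> u'" using Cons.prems(3) by auto
    ultimately show "\<not> (m x \<or> x \<in> R u)"
      using Cons.prems(2)[of u u'] Cons.prems(4)[of u' x] by auto
  qed (use Cons.prems in auto)
  then obtain t' where t': "for_each us f ?m = Some ((), \<lambda>x. ?m x \<or> x \<in> (\<Union>u \<in> set us. R u), t')"
      "t' \<le> Suc (\<Sum>u \<in> set us. Suc (B u))"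
    by auto
  show ?case
    using t t' Cons.prems(3) by (auto simp: ram_bind_def tick_def disj_assoc)
qed

lemma count_unmarked_spec:
  "\<exists>t. count_unmarked xs c m = Some (c + length (filter (\<lambda>x. \<not> m x) xs), m, t) \<and>
       t \<le> Suc (3 * length xs)"
proof (induction xs arbitrary: c)
  case Nil
  then show ?case by (simp add: ram_bind_def tick_def ram_return_def)
next
  case (Cons x xs)
  from Cons[of c] Cons[of "Suc c"] show ?case
    by (auto simp: ram_bind_def tick_def read_def)
qed

context child_system
begin

text \<open>The slack of 5 pays, in the loops of the parent, for the call (2 steps) and the counting (3 steps).\<close>

lemma cds_ram_spec:
  assumes "\<And>x. x \<in> descendants v \<Longrightarrow> distinct (ch x) \<and> set (ch x) = C x"
    and "\<And>x. x \<in> descendants v \<Longrightarrow> \<not> m x"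
  shows "\<exists>t. cds_ram ch v p m = Some ((), \<lambda>x. m x \<or> x \<in> cds_value v p, t) \<and>
             t + 5 \<le> 13 * card (descendants v)"
  using wf_children assms
proof (induction v arbitrary: p m rule: wf_induct_rule)
  case (less v)
  have ch: "distinct (ch v)" "set (ch v) = C v"
    using less.prems(1)[OF self_in_descendants] by auto
  show ?case
  proof (cases "C v = {}")
    case True
    then have "ch v = []" using ch by simp
    moreover have "card (descendants v) = 1"
      using True card_descendants[of v] by simp
    ultimately show ?thesis
      by (subst cds_ram.simps)
        (simp add: ram_bind_def tick_def ram_return_def cds_value_leaf[OF True])
  next
    case False
    define S where "S = (\<Union>u \<in> C v. cds_value u (Some v))"
    define m1 where "m1 = (\<lambda>x. m x \<or> x \<in> S)"
    \<comment> \<open>The induction hypothesis bounds the recursive call by 13 times the subtree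
      size minus 5, and the \<open>tick\<close> before it adds 1. By \<open>pos\<close> the
      subtraction is not truncated.\<close>
    define B where "B u = 13 * card (descendants u) - 4" for u
    have pos: "0 < card (descendants u)" for u
      using finite_descendants self_in_descendants by (auto simp: card_gt_0_iff)
    have sub: "x \<in> descendants v" if "u \<in> C v" "x \<in> descendants u" for u x
      using that descendants_unfold[of v] by blast
    have "\<exists>t. for_each (ch v) (\<lambda>u. do { tick; cds_ram ch u (Some v) }) m =
        Some ((), \<lambda>x. m x \<or> x \<in> (\<Union>u \<in> set (ch v). cds_value u (Some v)), t) \<and>
        t \<le> Suc (\<Sum>u \<in> set (ch v). Suc (B u))"
    proof (rule for_each_unions[where Q = descendants])
      fix u and m :: "'a \<Rightarrow> bool"
      assume u: "u \<in> set (ch v)" and m: "\<forall>x \<in> descendants u. \<not> m x"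
      have "\<exists>t. cds_ram ch u (Some v) m = Some ((), \<lambda>x. m x \<or> x \<in> cds_value u (Some v), t) \<and>
             t + 5 \<le> 13 * card (descendants u)"
        using u m ch by (intro less.IH less.prems(1) sub) auto
      then show "\<exists>t. (do { tick; cds_ram ch u (Some v) }) m =
          Some ((), \<lambda>x. m x \<or> x \<in> cds_value u (Some v), t) \<and> t \<le> B u"
        by (auto simp: ram_bind_def tick_def B_def)
    next
      fix u u' assume "u \<in> set (ch v)" "u' \<in> set (ch v)" "u \<noteq> u'"
      \<comment> \<open>Besides vertices of its own subtree a call can set only \<open>v\<close>,
        which lies in no subtree of a child.\<close>
      then show "cds_value u (Some v) \<inter> descendants u' = {}"
        using ch descendants_siblings_disjoint[of u v u'] parent_notin_descendants[of u' v]
        by (auto simp: cds_value_def)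
    qed (use ch less.prems(2) sub in auto)
    then obtain t1 where t1:
      "for_each (ch v) (\<lambda>u. do { tick; cds_ram ch u (Some v) }) m = Some ((), m1, t1)"
      "t1 \<le> Suc (\<Sum>u \<in> C v. Suc (B u))"
      unfolding m1_def S_def ch(2) by auto
    \<comment> \<open>The children of \<open>v\<close> are clear in \<open>m\<close>, so on the
      child list \<open>m1\<close> is membership in \<open>S\<close>.\<close>
    have "filter (\<lambda>x. \<not> m1 x) (ch v) = filter (\<lambda>x. x \<notin> S) (ch v)"
      using less.prems(2) children_subset_descendants ch by (intro filter_cong) (auto simp: m1_def)
    moreover have "length (filter (\<lambda>x. x \<notin> S) (ch v)) = card (C v - S)"
      using ch distinct_card[of "filter (\<lambda>x. x \<notin> S) (ch v)"] by (simp add: set_diff_eq)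
    ultimately obtain t2 where t2:
      "count_unmarked (ch v) 0 m1 = Some (card (C v - S), m1, t2)" "t2 \<le> Suc (3 * card (C v))"
      using count_unmarked_spec[of "ch v" 0 m1] ch distinct_card[of "ch v"] by auto
    \<comment> \<open>A child is charged \<open>B u\<close>, one step for its cell in the first loop
      and three in the counting loop.\<close>
    have "Suc (B u) + 3 = 13 * card (descendants u)" for u
      using pos[of u] by (simp add: B_def)
    then have "(\<Sum>u \<in> C v. 13 * card (descendants u)) = (\<Sum>u \<in> C v. Suc (B u) + 3)"
      by simp
    also have "\<dots> = (\<Sum>u \<in> C v. Suc (B u)) + 3 * card (C v)"
      by (simp only: sum.distrib sum_constant of_nat_id mult.commute)
    finally have "(\<Sum>u \<in> C v. Suc (B u)) + 3 * card (C v) = 13 * (\<Sum>u \<in> C v. card (descendants u))"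
      by (simp add: sum_distrib_left)
    then have "(\<Sum>u \<in> C v. Suc (B u)) + 3 * card (C v) + 13 = 13 * card (descendants v)"
      by (simp add: card_descendants[of v])
    \<comment> \<open>The 13 steps for \<open>v\<close> itself are the ends of the two loops (2), at
      most four ticks, one read and one write outside them (6), and the slack (5). The last two
      amounts make the 11.\<close>
    with t1 t2 have time: "t1 + t2 + 11 \<le> 13 * card (descendants v)" by linarith
    have "ch v \<noteq> []" using False ch by auto
    have m1v: "m1 v \<longleftrightarrow> v \<in> S"
      using less.prems(2)[OF self_in_descendants] by (simp add: m1_def)
    have upd: "m1(y := True) = (\<lambda>x. m x \<or> x \<in> S \<union> {y})" for y
      by (auto simp: m1_def fun_eq_iff)
    note bind_simps = ram_bind_tick ram_bind_read
      ram_bind_Some[where c = "for_each (ch v) (\<lambda>u. do { tick; cds_ram ch u (Some v) })" and m = m, OF t1(1)]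
      ram_bind_Some[where c = "count_unmarked (ch v) 0" and m = m1, OF t2(1)]
    have m1: "m1 = (\<lambda>x. m x \<or> x \<in> S)" by (simp add: m1_def)
    show ?thesis
      unfolding cds_value_step[of v p, folded S_def]
      using \<open>ch v \<noteq> []\<close> time m1v
      by (subst cds_ram.simps)
        (simp add: bind_simps ram_return_def write_def upd m1[symmetric])
  qed
qed

end

lemma for_each_write_False:
  "for_each vs (\<lambda>v. write v False) m = Some ((), \<lambda>x. m x \<and> x \<notin> set vs, 2 * length vs + 1)"
  by (induction vs arbitrary: m) (auto simp: tick_def write_def ram_bind_def)

text \<open>For \<open>n\<close> vertices, clearing takes \<open>2 * n + 1\<close> steps and the
  call at most \<open>13 * n - 5\<close>. Cells outside the tree keep their arbitrary content, hence
  the restriction to \<open>descendants r\<close>.\<close>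

lemma (in child_system) cds_main_spec:
  assumes "distinct vs" and "set vs = descendants r"
    and "\<And>x. x \<in> descendants r \<Longrightarrow> distinct (ch x) \<and> set (ch x) = C x"
  shows "\<exists>m' t. cds_main vs ch r m = Some ((), m', t) \<and>
           {v \<in> descendants r. m' v} = cds_value r None \<and> t \<le> 16 * card (descendants r)"
proof -
  let ?m = "\<lambda>x. m x \<and> x \<notin> set vs"
  obtain t where t: "cds_ram ch r None ?m = Some ((), \<lambda>x. ?m x \<or> x \<in> cds_value r None, t)"
      "t + 5 \<le> 13 * card (descendants r)"
    using cds_ram_spec[of r ch ?m None] assms by auto
  have "length vs = card (descendants r)"
    using assms distinct_card by metis
  then show ?thesis
    using t assms(2)
    by (auto simp: cds_main_def for_each_write_False ram_bind_def cds_value_def)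
qed

section \<open>Parents and children in a tree\<close>

text \<open>Paths are handled as vertex lists, but \<open>cycle\<close> speaks of arc lists; this
  translates between them.\<close>

lemma (in wf_digraph) vwalk_imp_awalk:
  assumes "vwalk p G"
  shows "\<exists>es. awalk (hd p) es (last p) \<and> awalk_verts (hd p) es = p"
  using assms
proof (induction p rule: vwalk_induct)
  case (Base u)
  then show ?case by (intro exI[of _ "[]"]) (simp add: awalk_Nil_iff)
next
  case (Cons u v es)
  then obtain as where as: "awalk v as (last (v # es))" "awalk_verts v as = v # es" by auto
  from Cons(1) obtain e where e: "e \<in> arcs G" "tail G e = u" "head G e = v" by auto
  show ?case
    using as e by (intro exI[of _ "e # as"]) (simp add: awalk_Cons_iff)
qed

lemma vwalk_snoc_iff:
  "p \<noteq> [] \<Longrightarrow> vwalk (p @ [x]) G \<longleftrightarrow> vwalk p G \<and> x \<in> verts G \<and> (last p, x) \<in> arcs_ends G"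
  by (auto simp: vwalk_def set_vwalk_arcs_snoc)

lemma closed_vpath_singleton:
  assumes "vpath p G" "hd p = last p"
  shows "p = [last p]"
proof (cases p)
  case (Cons a q)
  then show ?thesis
    using assms last_in_set[of q] by (cases "q = []") (auto simp: vpath_def)
qed (use assms in \<open>auto simp: vpath_def vwalk_def\<close>)

locale graph_tree = graph T for T :: "('a, 'b) pre_digraph" +
  fixes r :: 'a
  assumes tree_connected: "connected T"
    and tree_acyclic: "\<not> (\<exists>p. cycle p \<and> 3 \<le> length p)"
    and root_in_verts: "r \<in> verts T"
begin

section \<open>Acyclicity and uniqueness of paths from the root\<close>

lemma adj_sym: "u \<rightarrow>\<^bsub>T\<^esub> v \<Longrightarrow> v \<rightarrow>\<^bsub>T\<^esub> u"
  using sym_arcs by (rule arcs_ends_symmetric)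

text \<open>The arc would turn the path into a cycle with as many arcs as the path has vertices.
  Acyclicity is used only through this lemma.\<close>

lemma no_closing_arc:
  assumes p: "vpath p T" and len: "3 \<le> length p"
  shows "(last p, hd p) \<notin> arcs_ends T"
proof
  assume arc: "(last p, hd p) \<in> arcs_ends T"
  have ne: "p \<noteq> []" using len by auto
  have "vwalk (p @ [hd p]) T"
    using p arc ne by (auto simp: vwalk_snoc_iff vpath_def dest: adj_in_verts)
  then obtain es where es: "awalk (hd p) es (hd p)" "awalk_verts (hd p) es = p @ [hd p]"
    using vwalk_imp_awalk[of "p @ [hd p]"] ne by auto
  have "length es = length p"
    using length_awalk_verts[of "hd p" es] es(2) by simp
  moreover have "distinct (tl (p @ [hd p]))"
    using p ne by (cases p) (auto simp: vpath_def)
  ultimately have "cycle es \<and> 3 \<le> length es"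
    using es len unfolding cycle_def by (auto intro!: exI[of _ "hd p"])
  then show False using tree_acyclic by blast
qed

lemma no_triangle:
  assumes "x \<rightarrow>\<^bsub>T\<^esub> y" "y \<rightarrow>\<^bsub>T\<^esub> z"
  shows "(z, x) \<notin> arcs_ends T"
proof
  assume zx: "z \<rightarrow>\<^bsub>T\<^esub> x"
  have "vpath [x, y, z] T"
    using assms zx adj_not_same adj_in_verts by (auto simp: vpath_def vwalk_def)
  then show False using no_closing_arc[of "[x, y, z]"] zx by simp
qed

text \<open>If the predecessors differed, one path reversed and joined to the other would give a
  walk from \<open>v\<close> to \<open>v'\<close> avoiding \<open>u\<close>. Shortened to a path and
  extended by \<open>u\<close>, it is closed to a cycle by the edge between \<open>u\<close> and
  \<open>v\<close>.\<close>

lemma same_predecessor: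
  assumes "vpath (p @ [v, u]) T" "vpath (p' @ [v', u]) T" "hd (p @ [v]) = hd (p' @ [v'])"
  shows "v = v'"
proof (rule ccontr)
  assume "v \<noteq> v'"
  have w: "vwalk (p @ [v]) T" "vwalk (p' @ [v']) T" and arcs: "v \<rightarrow>\<^bsub>T\<^esub> u" "v' \<rightarrow>\<^bsub>T\<^esub> u"
    using assms vwalk_snoc_iff[of "p @ [v]" u T] vwalk_snoc_iff[of "p' @ [v']" u T]
    by (auto simp: vpath_def)
  have rev: "vwalk (rev (p @ [v])) T"
    using sym_arcs w(1) by (rule vwalk_rev_ex)
  let ?w = "rev (p @ [v]) \<oplus> (p' @ [v'])"
  have j: "joinable (rev (p @ [v])) (p' @ [v'])"
    using assms(3) by (intro joinableI) (auto simp: last_rev)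
  have walk: "vwalk ?w T" using rev w(2) j by (rule vwalk_joinI_vwalk)
  have ends: "hd ?w = v" "last ?w = v'"
    using j by (simp_all add: vwalk_join_hd vwalk_join_last)
  define q where "q = vwalk_to_vpath ?w"
  have q: "vpath q T" "hd q = v" "last q = v'"
    unfolding q_def using walk ends
    by (simp_all add: vwalk_to_vpath_vpath vwalk_to_vpath_hd vwalk_to_vpath_last)
  have "u \<notin> set ?w"
    using assms(1,2) by (auto simp: vwalk_join_def vpath_def dest: list.set_sel(2)[rotated])
  then have "u \<notin> set q" unfolding q_def using vwalk_to_vpath_subset by metis
  have "q \<noteq> []" using q(1) by (auto simp: vpath_def vwalk_def)
  have path: "vpath (q @ [u]) T"
    using q \<open>u \<notin> set q\<close> \<open>q \<noteq> []\<close> arcs adj_in_verts by (auto simp: vpath_def vwalk_snoc_iff)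
  have "2 \<le> length q"
  proof (rule ccontr)
    assume "\<not> 2 \<le> length q"
    then obtain z where "q = [z]" using \<open>q \<noteq> []\<close> by (cases q) (auto simp: Suc_le_eq)
    then show False using q \<open>v \<noteq> v'\<close> by simp
  qed
  then show False
    using no_closing_arc[OF path] q \<open>q \<noteq> []\<close> adj_sym[OF arcs(1)] by simp
qed

text \<open>Peel the paths from the end: by \<open>same_predecessor\<close> they agree in the vertex
  before the common last one. If one path is a single vertex, the other is closed and hence single
  too.\<close>

lemma root_path_unique:
  assumes "vpath p T" "vpath q T" "hd p = r" "hd q = r" "last p = last q"
  shows "p = q"
  using assms
proof (induction p arbitrary: q rule: rev_induct)
  case Nil
  then show ?case by (simp add: vpath_def vwalk_def)
next
  case (snoc x p)
  obtain q' where q': "q = q' @ [x]"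
    using snoc.prems by (cases q rule: rev_cases) (auto simp: vpath_def vwalk_def)
  consider "p = []" | "q' = []" | p1 v q1 w where "p = p1 @ [v]" "q' = q1 @ [w]"
    by (metis rev_exhaust)
  then show ?case
  proof cases
    case 1
    then show ?thesis using closed_vpath_singleton[of q T] snoc.prems by simp
  next
    case 2
    then show ?thesis using closed_vpath_singleton[of "p @ [x]" T] snoc.prems q' by simp
  next
    case (3 p1 v q1 w)
    have ne: "p \<noteq> []" "q' \<noteq> []" using 3 by auto
    have hds: "hd p = r" "hd q' = r" using snoc.prems(3,4) q' ne by auto
    have paths: "vpath p T" "vpath q' T"
      using snoc.prems(1,2) q' ne by (auto simp: vpath_def vwalk_snoc_iff)
    have "v = w"
      by (rule same_predecessor[of p1 v x q1 w]) (use snoc.prems(1,2) q' 3 hds in auto)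
    then have "p = q'" using snoc.IH[OF paths(1) paths(2) hds] 3 by simp
    then show ?thesis using q' by simp
  qed
qed

lemma root_path_exists:
  assumes "v \<in> verts T"
  shows "\<exists>p. vpath p T \<and> hd p = r \<and> last p = v"
proof -
  have "r \<rightarrow>\<^sup>*\<^bsub>mk_symmetric T\<^esub> v"
    using tree_connected assms root_in_verts by (auto simp: connected_def)
  then have "r \<rightarrow>\<^sup>*\<^bsub>T\<^esub> v" using reachable_mk_symmetric_eq sym_arcs by blast
  then show ?thesis by (simp add: reachable_vpath_conv)
qed

section \<open>The child relation of the rooted tree\<close>

lemma childE:
  assumes "u \<in> children T r v"
  obtains q where "vpath (q @ [v, u]) T" "vpath (q @ [v]) T" "hd (q @ [v]) = r"
proof -
  from assms obtain q where q: "vpath (q @ [v, u]) T" "hd (q @ [v, u]) = r"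
    by (auto simp: children_def)
  have "vpath (q @ [v]) T"
    using q(1) vwalk_snoc_iff[of "q @ [v]" u T] by (auto simp: vpath_def)
  moreover have "hd (q @ [v]) = r" using q(2) by (cases q) auto
  ultimately show ?thesis using q(1) that by blast
qed

lemma child_adj: "u \<in> children T r v \<Longrightarrow> v \<rightarrow>\<^bsub>T\<^esub> u"
  by (erule childE) (use vwalk_snoc_iff[of "_ @ [v]" u T] in \<open>auto simp: vpath_def\<close>)

lemma child_unique_parent:
  "u \<in> children T r v \<Longrightarrow> u \<in> children T r w \<Longrightarrow> v = w"
  by (elim childE) (metis same_predecessor)

text \<open>Take the root path to \<open>x\<close>. If it avoids \<open>y\<close>, it extends to
  \<open>y\<close>. Otherwise the edge would close its part from \<open>y\<close> to
  \<open>x\<close> to a cycle, unless \<open>y\<close> comes directly before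
  \<open>x\<close>.\<close>

lemma adj_imp_child:
  assumes "x \<rightarrow>\<^bsub>T\<^esub> y"
  shows "y \<in> children T r x \<or> x \<in> children T r y"
proof -
  obtain p where p: "vpath p T" "hd p = r" "last p = x"
    using root_path_exists[of x] adj_in_verts assms by blast
  have "p \<noteq> []" using p(1) by (auto simp: vpath_def vwalk_def)
  then have px: "p = butlast p @ [x]" using p(3) by auto
  show ?thesis
  proof (cases "y \<in> set p")
    case False
    then have "vpath (p @ [y]) T"
      using p assms \<open>p \<noteq> []\<close> adj_in_verts by (auto simp: vpath_def vwalk_snoc_iff)
    then have "vpath (butlast p @ [x, y]) T" using px by (metis append.assoc append_Cons append_Nil)
    moreover have "hd (butlast p @ [x, y]) = r"
      using p(2) px by (metis append_is_Nil_conv hd_append list.sel(1))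
    ultimately show ?thesis unfolding children_def by blast
  next
    case True
    have "x \<noteq> y" using assms adj_not_same by blast
    then have "y \<in> set (butlast p)" using True px by (metis Un_iff empty_iff insert_iff list.set set_append)
    then obtain a b where "butlast p = a @ y # b" by (meson split_list)
    then have pab: "p = a @ (y # b @ [x])" using px by simp
    have path: "vpath (y # b @ [x]) T"
      using p(1) vwalkI_append_r[of "y # b @ [x]" a T] unfolding pab by (auto simp: vpath_def)
    have "b = []"
    proof (rule ccontr)
      assume "b \<noteq> []"
      then have "3 \<le> length (y # b @ [x])" by (cases b) auto
      from no_closing_arc[OF path this] assms show False by simp
    qed
    then have "vpath (a @ [y, x]) T" "hd (a @ [y, x]) = r" using p pab by auto
    then show ?thesis unfolding children_def by blast
  qed
qed

lemma children_subset_verts: "children T r v \<subseteq> verts T"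
  using child_adj adj_in_verts by blast

text \<open>The depth, counted in vertices of the unique root path, grows by one from parent to
  child and is at most the number of vertices.\<close>

lemma wf_child_relation: "wf {(u, v). u \<in> children T r v}"
proof -
  define depth where "depth v = length (THE p. vpath p T \<and> hd p = r \<and> last p = v)" for v
  have depth: "depth (last p) = length p" if "vpath p T" "hd p = r" for p
  proof -
    have "(THE q. vpath q T \<and> hd q = r \<and> last q = last p) = p"
      using that by (intro the_equality) (auto intro: root_path_unique)
    then show ?thesis by (simp add: depth_def)
  qed
  have "{(u, v). u \<in> children T r v} \<subseteq> measure (\<lambda>v. Suc (card (verts T)) - depth v)"
  proof (clarsimp)
    fix u v assume "u \<in> children T r v"
    then obtain q where q: "vpath (q @ [v, u]) T" "vpath (q @ [v]) T" "hd (q @ [v]) = r"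
      by (rule childE)
    have "hd (q @ [v, u]) = r" using q(3) by (cases q) auto
    then have "depth u = Suc (depth v)"
      using depth[OF q(1)] depth[OF q(2,3)] by simp
    moreover have "depth u = card (set (q @ [v, u]))"
      using depth[OF q(1)] \<open>hd (q @ [v, u]) = r\<close> q(1) distinct_card[of "q @ [v, u]"]
      by (simp add: vpath_def del: set_append)
    moreover have "card (set (q @ [v, u])) \<le> card (verts T)"
      using q(1) by (intro card_mono) (auto simp: vpath_def vwalk_def)
    ultimately show "Suc (card (verts T)) - depth u < Suc (card (verts T)) - depth v" by linarith
  qed
  then show ?thesis by (rule wf_subset[OF wf_measure])
qed

sublocale child_system "children T r"
proof
  show "finite (children T r v)" for v
    using finite_subset[OF children_subset_verts] by simp
qed (fact child_unique_parent wf_child_relation)+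

lemma descendants_root: "descendants r = verts T"
proof
  have "x \<in> verts T" if "x \<in> descendants v" "v \<in> verts T" for x v
    using that unfolding descendants_def mem_Collect_eq
    by (induction rule: converse_rtrancl_induct) (use children_subset_verts in blast)+
  then show "descendants r \<subseteq> verts T" using root_in_verts by blast
  have "last p \<in> descendants r" if "vpath p T" "hd p = r" for p
    using that
  proof (induction p rule: rev_induct)
    case (snoc x p)
    show ?case
    proof (cases "p = []")
      case True
      then show ?thesis using snoc.prems self_in_descendants by simp
    next
      case False
      then obtain q v where p: "p = q @ [v]" by (metis rev_exhaust)
      have "vpath p T" using snoc.prems(1) False by (auto simp: vpath_def vwalk_snoc_iff)
      moreover have "hd p = r" using snoc.prems(2) False by simp
      ultimately have "v \<in> descendants r" using snoc.IH p by simp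
      moreover have "x \<in> children T r v"
        using snoc.prems p unfolding children_def by auto
      ultimately show ?thesis
        using children_subset_descendants descendants_trans by fastforce
    qed
  qed (simp add: vpath_def vwalk_def)
  then show "verts T \<subseteq> descendants r" using root_path_exists by blast
qed

end

section \<open>Claws\<close>

lemma induce_induce_subgraph: "W \<subseteq> A \<Longrightarrow> (G \<restriction> A) \<restriction> W = G \<restriction> W"
  by (auto simp: induce_subgraph_def)

lemma arcs_ends_induce_subgraph: "arcs_ends (G \<restriction> W) = arcs_ends G \<inter> W \<times> W"
  by (auto simp: arcs_ends_conv)

lemma (in graph) graph_induce_subgraph:
  assumes "W \<subseteq> verts G"
  shows "graph (G \<restriction> W)"
proof -
  interpret H: wf_digraph "G \<restriction> W" by (rule wellformed_induce_subgraph)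
  show ?thesis
  proof
    show "symmetric (G \<restriction> W)"
      using sym_arcs induced_induce[OF assms] by (rule induced_graph_imp_symmetric)
  qed (use assms no_multi_arcs no_loops in \<open>auto intro: finite_subset simp: arc_to_ends_def\<close>)
qed

context graph_tree
begin

text \<open>Inducedness is automatic in a tree: an edge between two leaves of the star would form a
  triangle with the center.\<close>

lemma claw_iff:
  assumes "W \<subseteq> verts T"
  shows "K\<^bsub>1,3\<^esub> (T \<restriction> W) \<longleftrightarrow> (\<exists>c L. W = insert c L \<and> card L = 3 \<and> (\<forall>l \<in> L. c \<rightarrow>\<^bsub>T\<^esub> l))"
proof
  assume "K\<^bsub>1,3\<^esub> (T \<restriction> W)"
  then obtain U L where UL: "W = U \<union> L" "card U = 1" "card L = 3"
      "arcs_ends (T \<restriction> W) = U \<times> L \<union> L \<times> U"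
    unfolding complete_bipartite_digraph_def by auto
  from UL(2) obtain c where "U = {c}" by (auto simp: card_1_singleton_iff)
  then show "\<exists>c L. W = insert c L \<and> card L = 3 \<and> (\<forall>l \<in> L. c \<rightarrow>\<^bsub>T\<^esub> l)"
    using UL by (intro exI[of _ c] exI[of _ L]) (auto simp: arcs_ends_induce_subgraph)
next
  assume "\<exists>c L. W = insert c L \<and> card L = 3 \<and> (\<forall>l \<in> L. c \<rightarrow>\<^bsub>T\<^esub> l)"
  then obtain c L where W: "W = insert c L" "card L = 3" and adj: "\<And>l. l \<in> L \<Longrightarrow> c \<rightarrow>\<^bsub>T\<^esub> l"
    by auto
  have "\<not> l \<rightarrow>\<^bsub>T\<^esub> l'" if "l \<in> L" "l' \<in> L" for l l'
    using no_triangle[of c l l'] adj that adj_sym by blast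
  moreover have "c \<notin> L" "\<not> c \<rightarrow>\<^bsub>T\<^esub> c" using adj adj_not_same by blast+
  ultimately have "verts (T \<restriction> W) = {c} \<union> L \<and> {c} \<inter> L = {} \<and> card {c} = 1 \<and> card L = 3 \<and>
      arcs_ends (T \<restriction> W) = {c} \<times> L \<union> L \<times> {c}"
    using W adj adj_sym by (auto simp: arcs_ends_induce_subgraph)
  then show "K\<^bsub>1,3\<^esub> (T \<restriction> W)"
    unfolding complete_bipartite_digraph_def using graph_induce_subgraph[OF assms] by blast
qed

text \<open>Turns the problem into hitting all stars with three leaves. Their leaf sets are
  nonempty, so the adjacencies place each whole star in \<open>T\<close>.\<close>

lemma claw_deletion_set_iff:
  "claw_deletion_set T S \<longleftrightarrow> S \<subseteq> verts T \<and>
     (\<forall>c L. card L = 3 \<longrightarrow> (\<forall>l \<in> L. c \<rightarrow>\<^bsub>T\<^esub> l) \<longrightarrow> insert c L \<inter> S \<noteq> {})"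
proof -
  have in_verts: "insert c L \<subseteq> verts T" if "card L = 3" "\<forall>l \<in> L. c \<rightarrow>\<^bsub>T\<^esub> l" for c L
  proof -
    from that(1) have "L \<noteq> {}" by auto
    with that(2) show ?thesis using adj_in_verts by blast
  qed
  have "claw_free (T \<restriction> (verts T - S)) \<longleftrightarrow>
      \<not> (\<exists>W \<subseteq> verts T - S. \<exists>c L. W = insert c L \<and> card L = 3 \<and> (\<forall>l \<in> L. c \<rightarrow>\<^bsub>T\<^esub> l))"
    unfolding claw_free_def induce_subgraph_verts
    by (intro arg_cong[where f = Not] ex_cong1 conj_cong refl)
      (subst induce_induce_subgraph, assumption, rule claw_iff, blast)
  also have "\<dots> \<longleftrightarrow>
      \<not> (\<exists>c L. card L = 3 \<and> (\<forall>l \<in> L. c \<rightarrow>\<^bsub>T\<^esub> l) \<and> insert c L \<subseteq> verts T - S)"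
    by metis
  also have "\<dots> \<longleftrightarrow> \<not> (\<exists>c L. card L = 3 \<and> (\<forall>l \<in> L. c \<rightarrow>\<^bsub>T\<^esub> l) \<and> insert c L \<inter> S = {})"
    by (intro arg_cong[where f = Not] ex_cong1 conj_cong refl) (drule (1) in_verts, blast)
  finally show ?thesis
    unfolding claw_deletion_set_def by (simp only: not_ex de_Morgan_conj imp_conv_disj)
qed

section \<open>Feasibility and optimality of the marked set\<close>

lemma marked_in_verts:
  assumes "marked v" shows "v \<in> verts T"
proof -
  have "children T r v \<noteq> {}"
    using assms marked_iff[of v] by (auto simp: unmarked_children_def)
  then show ?thesis using child_adj adj_in_verts by blast
qed

lemma marked_claw_deletion_set: "claw_deletion_set T (Collect marked)"
  unfolding claw_deletion_set_iff
proof (intro conjI allI impI notI)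
  show "Collect marked \<subseteq> verts T" using marked_in_verts by auto
next
  fix c L
  assume L: "card L = 3" "\<forall>l \<in> L. c \<rightarrow>\<^bsub>T\<^esub> l" and disj: "insert c L \<inter> Collect marked = {}"
  have fin: "finite L" using L(1) by (metis card.infinite zero_neq_numeral)
  let ?K = "L \<inter> children T r c"
  have "card ?K \<le> card (unmarked_children c)"
    using disj by (intro card_mono finite_unmarked_children) (auto simp: unmarked_children_def)
  moreover have "\<not> marked c" using disj by auto
  ultimately have "card ?K \<le> 2" using unmarked_card_le[of c] by simp
  \<comment> \<open>The unmarked center has at most two unmarked children, so one of the three
    leaves is its parent \<open>p\<close>. As the parent is unique, two leaves remain as
    children.\<close>
  then have "L \<inter> children T r c \<noteq> L" using L(1) by auto
  then obtain p where p: "p \<in> L" "p \<notin> children T r c" by blast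
  have cp: "c \<in> children T r p" using adj_imp_child[of c p] L(2) p by blast
  have "L - children T r c \<subseteq> {p}"
  proof
    fix l assume "l \<in> L - children T r c"
    then have "c \<in> children T r l" using adj_imp_child[of c l] L(2) by blast
    then show "l \<in> {p}" using cp child_unique_parent by blast
  qed
  then have "card (L - ?K) \<le> 1"
    using card_mono[of "{p}" "L - ?K"] by auto
  then have "2 \<le> card ?K"
    using L(1) fin card_Diff_subset[of ?K L] by auto
  then have "2 \<le> card (unmarked_children c)"
    using \<open>card ?K \<le> card (unmarked_children c)\<close> by linarith
  then have "marked p" using marked_iff[of p] cp \<open>\<not> marked c\<close> by blast
  then show False using disj p by blast
qed

text \<open>The clauses of \<open>marked_iff\<close> give the claw: center \<open>s\<close> with
  three unmarked children, or center an unmarked child \<open>u\<close> whose leaves are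
  \<open>s\<close> and two unmarked children of \<open>u\<close>.\<close>

lemma marked_private_claw:
  assumes s: "marked s"
  shows "\<exists>c L. card L = 3 \<and> (\<forall>l \<in> L. c \<rightarrow>\<^bsub>T\<^esub> l) \<and>
    (\<forall>x \<in> insert c L - {s}. \<not> marked x \<and>
       (x \<in> children T r s \<or> (\<exists>u \<in> children T r s. \<not> marked u \<and> x \<in> children T r u)))"
  using s unfolding marked_iff[of s]
proof (elim disjE bexE conjE)
  assume "3 \<le> card (unmarked_children s)"
  then obtain L where L: "L \<subseteq> unmarked_children s" "card L = 3"
    by (rule obtain_subset_with_card_n)
  then show ?thesis
    by (intro exI[of _ s] exI[of _ L]) (auto simp: unmarked_children_def child_adj)
next
  fix u assume u: "u \<in> children T r s" "\<not> marked u" and "2 \<le> card (unmarked_children u)"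
  then obtain L where L: "L \<subseteq> unmarked_children u" "card L = 2" "finite L"
    using obtain_subset_with_card_n by metis
  have "s \<notin> L" using L(1) s by (auto simp: unmarked_children_def)
  then have "card (insert s L) = 3" using L by simp
  then show ?thesis
    using L u by (intro exI[of _ u] exI[of _ "insert s L"])
      (auto simp: unmarked_children_def child_adj adj_sym)
qed

lemma card_marked_le:
  assumes S: "claw_deletion_set T S"
  shows "card (Collect marked) \<le> card S"
proof -
  have "\<exists>x \<in> S. x = s \<or> \<not> marked x \<and>
      (x \<in> children T r s \<or> (\<exists>u \<in> children T r s. \<not> marked u \<and> x \<in> children T r u))"
    if "marked s" for s
    using marked_private_claw[OF that] S unfolding claw_deletion_set_iff by blast
  then obtain f where f: "\<And>s. marked s \<Longrightarrow> f s \<in> S"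
    "\<And>s. marked s \<Longrightarrow> f s = s \<or> \<not> marked (f s) \<and>
      (f s \<in> children T r s \<or> (\<exists>u \<in> children T r s. \<not> marked u \<and> f s \<in> children T r u))"
    by metis
  \<comment> \<open>The value \<open>f s\<close> determines \<open>s\<close>: if it is marked, it is
    \<open>s\<close>; otherwise \<open>s\<close> is its parent if that parent is marked, and its
    grandparent if not.\<close>
  have "inj_on f (Collect marked)"
  proof (rule inj_onI, clarsimp)
    fix s s' assume "marked s" "marked s'" "f s = f s'"
    then show "s = s'" using f(2)[of s] f(2)[of s'] child_unique_parent by metis
  qed
  moreover have "finite S"
    using S finite_subset[of S "verts T"] by (auto simp: claw_deletion_set_def)
  ultimately show ?thesis
    using f(1) by (intro card_inj_on_le[of f]) auto
qed

lemma cds_value_root: "cds_value r None = Collect marked"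
  using marked_in_verts by (auto simp: cds_value_def descendants_root)

end

theorem theorem7:
  shows "\<exists>K :: nat. \<forall>(T :: ('a, 'b) pre_digraph) r. rooted_tree T r \<longrightarrow>
    (\<exists>S. (\<forall>S'. cds_returns T r r None S' \<longleftrightarrow> S' = S) \<and>
         minimum_claw_deletion_set T S \<and>
         (\<forall>vs ch m. tree_input T r vs ch \<longrightarrow>
            (\<exists>m' t. cds_main vs ch r m = Some ((), m', t) \<and>
                    {v \<in> verts T. m' v} = S \<and>
                    t \<le> K * card (verts T))))"
proof (intro exI[of _ 16] allI impI)
  fix T :: "('a, 'b) pre_digraph" and r
  assume "rooted_tree T r"
  then interpret graph_tree T r
    by (auto simp: rooted_tree_def undirected_tree_def graph_tree_def graph_tree_axioms_def)
  show "\<exists>S. (\<forall>S'. cds_returns T r r None S' \<longleftrightarrow> S' = S) \<and>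
         minimum_claw_deletion_set T S \<and>
         (\<forall>vs ch m. tree_input T r vs ch \<longrightarrow>
            (\<exists>m' t. cds_main vs ch r m = Some ((), m', t) \<and>
                    {v \<in> verts T. m' v} = S \<and> t \<le> 16 * card (verts T)))"
  proof (intro exI[of _ "Collect marked"] conjI allI impI)
    show "cds_returns T r r None S' \<longleftrightarrow> S' = Collect marked" for S'
      using cds_returns_iff[OF child_system_axioms] by (simp add: cds_value_root)
    show "minimum_claw_deletion_set T (Collect marked)"
      unfolding minimum_claw_deletion_set_def
      using marked_claw_deletion_set card_marked_le by blast
  next
    fix vs ch m
    assume "tree_input T r vs ch"
    then show "\<exists>m' t. cds_main vs ch r m = Some ((), m', t) \<and>
        {v \<in> verts T. m' v} = Collect marked \<and> t \<le> 16 * card (verts T)"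
      using cds_main_spec[of vs r ch m]
      by (simp add: tree_input_def descendants_root cds_value_root)
  qed
qed

end
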